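(* Let $k\ge 1$ and $n$ be positive integers and let $l_1,\dots,l_k$ be integers with $l_i>1$ for $i=1,\dots,k$ and $l_1+\dots+l_k=n$. Let $$S=\{\lambda_1,\lambda_2,\dots,\lambda_k,\underbrace{\lambda_{k+1},\dots,\lambda_{k+1}}_{l_1-1},\underbrace{\lambda_{k+2},\dots,\lambda_{k+2}}_{l_2-1},\dots,\underbrace{\lambda_{2k},\dots,\lambda_{2k}}_{l_k-1}\}$$ be a list of real numbers. Suppose that: (1) $\lambda_1>0$ and $\lambda_2,\lambda_3,\dots,\lambda_{2k}<0$; (2) $\lambda_1,\lambda_2,\dots,\lambda_k$ are the roots, counted with multiplicity, of the characteristic polynomial of the $k\times k$ matrix $D^{(k)}$ with entries $$(D^{(k)})_{ij}=\begin{cases}(l_{k-j+1}-1)(2x_{k-j+1}) & \text{if } i=j,\\ l_{k-j+1}(x_{k-j+1}+x_{k-i+1}) & \text{if } i\ne j,\end{cases}\qquad 1\le i,j\le k,$$ where $x_i:=-\frac{\lambda_{k+i}}{2}$ for $i=1,2,\dots,k$. Then there is an $n\times n$ cell matrix $D(\vec{x})$ such that $\sigma(D(\vec{x}))=S$. Explicitly, this holds for the cell matrix $D(\vec{x})$ constructed from the vector $$\vec{x}=\Big(\underbrace{-\tfrac{\lambda_{k+1}}{2},\dots,-\tfrac{\lambda_{k+1}}{2}}_{l_1},\underbrace{-\tfrac{\lambda_{k+2}}{2},\dots,-\tfrac{\lambda_{k+2}}{2}}_{l_2},\dots,\underbrace{-\tfrac{\lambda_{2k}}{2},\dots,-\t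frac{\lambda_{2k}}{2}}_{l_k}\Big).$$
   Context: For a vector $\vec{x}=(x_1,\dots,x_n)$ of positive real numbers, the cell matrix $D(\vec{x})\in\mathbb{R}^{n\times n}$ associated with $\vec{x}$ is defined by $(D(\vec{x}))_{ij}=0$ if $i=j$ and $(D(\vec{x}))_{ij}=x_i+x_j$ if $i\neq j$. For a square matrix $A$, $\sigma(A)$ denotes the spectrum of $A$, i.e. the collection of all its eigenvalues; here it is a list (multiset) in which eigenvalues are counted with algebraic multiplicity, and equality of lists is equality as multisets. *)

theory Defs
  imports Complex_Main "Jordan_Normal_Form.Char_Poly"
begin

definition cell_matrix :: "real vec \<Rightarrow> real mat" where
  "cell_matrix x = mat (dim_vec x) (dim_vec x)
     (\<lambda>(i, j). if i = j then 0 else x $ i + x $ j)"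

text \<open>Cell matrices are formed from vectors of positive numbers only, a condition that
  \<open>cell_matrix\<close> itself does not impose.\<close>

definition is_cell_matrix :: "nat \<Rightarrow> real mat \<Rightarrow> bool" where
  "is_cell_matrix n D \<longleftrightarrow>
     (\<exists>x \<in> carrier_vec n. (\<forall>i<n. x $ i > 0) \<and> D = cell_matrix x)"

text \<open>The spectrum with algebraic multiplicities. The roots are taken over the complex
  numbers, so that no non-real eigenvalue is lost.\<close>

definition spectrum_mset :: "real mat \<Rightarrow> complex multiset" where
  "spectrum_mset A = proots (char_poly (map_mat complex_of_real A))"

text \<open>The \<open>k \<times> k\<close> matrix $D^{(k)}$. Here \<open>l\<close> and \<open>x\<close> are indexed by \<open>1, \<dots>, k\<close>, while matrix
  positions start at \<open>0\<close>: in position \<open>(a, b)\<close>, row \<open>i = a + 1\<close> and column \<open>j = b + 1\<close> give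
  \<open>k - i + 1 = k - a\<close> and \<open>k - j + 1 = k - b\<close>.\<close>

definition block_matrix :: "nat \<Rightarrow> (nat \<Rightarrow> nat) \<Rightarrow> (nat \<Rightarrow> real) \<Rightarrow> real mat" where
  "block_matrix k l x = mat k k (\<lambda>(a, b).
     if a = b then (real (l (k - b)) - 1) * (2 * x (k - b))
     else real (l (k - b)) * (x (k - b) + x (k - a)))"

definition repeat_blocks :: "nat \<Rightarrow> (nat \<Rightarrow> nat) \<Rightarrow> (nat \<Rightarrow> real) \<Rightarrow> real list" where
  "repeat_blocks k m y = concat (map (\<lambda>i. replicate (m i) (y i)) [1..<k+1])"

end

theory Submission
  imports Defs
begin

text \<open>The vector \<open>X\<close> is constant on \<open>k\<close> blocks, so its cell matrix is \<open>P B P\<^sup>T - diag\<close>, where \<open>P\<close> is the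
  \<open>n \<times> k\<close> indicator matrix of the blocks and \<open>B\<close> has the entries \<open>x\<^sub>a + x\<^sub>b\<close>. A Schur complement
  argument moves \<open>P\<close> to the other side, so that \<open>P\<^sup>T P = diag(l\<^sub>1, \<dots>, l\<^sub>k)\<close> appears and the
  characteristic polynomial of the cell matrix is the one of \<open>D\<^bsup>(k)\<^esup>\<close> times the product of
  \<open>(t + 2x\<^sub>a)\<^bsup>l\<^sub>a - 1\<^esup>\<close>.\<close>

text \<open>The products of \<open>d\<close> stand on both sides instead of in a quotient, so the
  identity applies to polynomial entries: there \<open>d a\<close> is a linear polynomial and has no
  inverse.\<close>

lemma det_diag_minus_block_constant:
  fixes d :: "nat \<Rightarrow> 'a :: idom" and B :: "nat \<Rightarrow> nat \<Rightarrow> 'a" and g :: "nat \<Rightarrow> nat"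
  assumes g: "\<And>i. i < n \<Longrightarrow> g i < k"
  shows "det (mat n n (\<lambda>(i, j). (if i = j then d (g i) else 0) - B (g i) (g j))) * (\<Prod>a<k. d a)
       = (\<Prod>i<n. d (g i)) * det (mat k k (\<lambda>(a, b). (if a = b then d a else 0)
            - B a b * of_nat (card {i. i < n \<and> g i = b})))"
    (is "det ?M * _ = _ * det ?N")
proof -
  define P :: "'a mat" where "P = mat n k (\<lambda>(i, a). if g i = a then 1 else 0)"
  define Q :: "'a mat" where "Q = mat k n (\<lambda>(a, j). B a (g j))"
  define E :: "'a mat" where "E = mat n n (\<lambda>(i, j). if i = j then d (g i) else 0)"
  define F :: "'a mat" where "F = mat k k (\<lambda>(a, b). if a = b then d a else 0)"
  have c [simp]: "P \<in> carrier_mat n k" "Q \<in> carrier_mat k n" "E \<in> carrier_mat n n"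
    "F \<in> carrier_mat k k" "?M \<in> carrier_mat n n" "?N \<in> carrier_mat k k"
    by (auto simp: P_def Q_def E_def F_def)
  have detE: "det E = (\<Prod>i<n. d (g i))"
    by (subst det_upper_triangular[of _ n])
       (auto simp: E_def diag_mat_def prod.distinct_set_conv_list[symmetric] atLeast0LessThan)
  have detF: "det F = (\<Prod>a<k. d a)"
    by (subst det_upper_triangular[of _ k])
       (auto simp: F_def diag_mat_def prod.distinct_set_conv_list[symmetric] atLeast0LessThan)
  have PQ: "E + P * (- Q) = ?M"
    by (rule eq_matI)
       (auto simp: E_def P_def Q_def scalar_prod_def g if_distrib[of "\<lambda>x. x * _"] cong: if_cong)
  have QP: "Q * (- P) + F = ?N"
  proof (rule eq_matI, goal_cases)
    case (1 a b)
    \<comment> \<open>\<open>B a (g i)\<close> is constant on the fibre of \<open>g\<close> over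
      \<open>b\<close>, so the sum becomes \<open>B a b\<close> times the size of that
      fibre.\<close>
    have "(\<Sum>i = 0..<n. if g i = b then B a (g i) else 0) = (\<Sum>i | i < n \<and> g i = b. B a b)"
      by (rule sum.mono_neutral_cong_right) auto
    with 1 show ?case
      by (auto simp: F_def P_def Q_def scalar_prod_def sum_negf mult.commute
            if_distrib[of "\<lambda>x. _ * x"] cong: if_cong)
  qed (auto simp: F_def)
  \<comment> \<open>Row \<open>i\<close> of \<open>P\<close> is nonzero only in column
    \<open>g i\<close>, so scaling rows by \<open>d (g i)\<close> equals scaling columns by
    \<open>d a\<close>. The relation \<open>E * P = P * F\<close> replaces the inverse of
    \<open>E\<close> in the usual Schur complement.\<close>
  have EP: "E * (- P) + P * F = 0\<^sub>m n k"
    by (rule eq_matI)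
       (auto simp: E_def P_def F_def scalar_prod_def g if_distrib[of "\<lambda>x. x * _"] cong: if_cong)
  \<comment> \<open>The same block matrix is multiplied by two triangular ones: here
    \<open>Q\<close> is cleared and \<open>E - P * Q\<close> appears; next \<open>P\<close> is
    cleared, at the cost of a factor \<open>det F\<close>, and \<open>F - Q * P\<close>
    appears.\<close>
  have 1: "four_block_mat E P Q (1\<^sub>m k) * four_block_mat (1\<^sub>m n) (0\<^sub>m n k) (- Q) (1\<^sub>m k)
      = four_block_mat ?M P (0\<^sub>m k n) (1\<^sub>m k)"
  proof -
    have "Q * 1\<^sub>m n + 1\<^sub>m k * (- Q) = 0\<^sub>m k n"
      by (simp add: left_mult_one_mat[of _ k n] right_mult_one_mat[of _ k n] comm_add_mat[of Q k n])
    moreover have "E * 1\<^sub>m n + P * (- Q) = ?M"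
      by (simp only: right_mult_one_mat[OF c(3)] PQ)
    moreover have "E * 0\<^sub>m n k + P * 1\<^sub>m k = P" "Q * 0\<^sub>m n k + 1\<^sub>m k * 1\<^sub>m k = 1\<^sub>m k"
      by (simp_all add: right_mult_one_mat[OF c(1)] right_mult_zero_mat[OF c(2)]
            right_mult_zero_mat[OF c(3)] left_add_zero_mat[OF c(1)])
    ultimately show ?thesis
      by (subst mult_four_block_mat[of _ n n _ k _ k _ _ n _ k]) (simp_all only: c, simp_all)
  qed
  have 2: "four_block_mat E P Q (1\<^sub>m k) * four_block_mat (1\<^sub>m n) (- P) (0\<^sub>m k n) F
      = four_block_mat E (0\<^sub>m n k) Q ?N"
  proof -
    have "E * 1\<^sub>m n + P * 0\<^sub>m k n = E" "Q * 1\<^sub>m n + 1\<^sub>m k * 0\<^sub>m k n = Q"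
      by (simp_all add: right_mult_one_mat[OF c(2)] right_mult_one_mat[OF c(3)]
            right_mult_zero_mat[OF c(1)] right_add_zero_mat[OF c(2)] right_add_zero_mat[OF c(3)])
    thus ?thesis
      by (subst mult_four_block_mat[of _ n n _ k _ k _ _ n _ k]) (simp_all add: left_mult_one_mat[OF c(4)] EP QP)
  qed
  have "det ?M * det F = det (four_block_mat E P Q (1\<^sub>m k)) * det F"
    using arg_cong[OF 1, of det]
    by (simp add: det_mult[of _ "n + k"] det_four_block_mat_lower_left_zero[of _ n _ k]
          det_four_block_mat_upper_right_zero[of _ n _ k])
  also have "\<dots> = det E * det ?N"
    using arg_cong[OF 2, of det]
    by (simp add: det_mult[of _ "n + k"] det_four_block_mat_lower_left_zero[of _ n _ k]
          det_four_block_mat_upper_right_zero[of _ n _ k])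
  finally show ?thesis
    by (simp only: detE detF)
qed

text \<open>Separating block indices from values keeps blocks distinguishable even when some of the
  \<open>y i\<close> coincide, so block sizes can be counted on the indices.\<close>

lemma repeat_blocks_conv_map:
  "repeat_blocks k m y = map y (concat (map (\<lambda>i. replicate (m i) i) [1..<k+1]))"
  by (simp add: repeat_blocks_def map_concat comp_def)

lemma prod_list_concat_replicate:
  fixes f :: "'b \<Rightarrow> 'a :: comm_monoid_mult"
  shows "prod_list (map f (concat (map (\<lambda>i. replicate (m i) i) xs))) = prod_list (map (\<lambda>i. f i ^ m i) xs)"
  by (induction xs) auto

lemma count_list_replicate: "count_list (replicate n x) y = (if x = y then n else 0)"
  by (induction n) auto

lemma count_list_concat_replicate:
  "distinct xs \<Longrightarrow> count_list (concat (map (\<lambda>i. replicate (m i) i) xs)) a = (if a \<in> set xs then m a else 0)"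
  by (induction xs) (auto simp: count_list_replicate)

lemma image_mset_repeat_blocks:
  "image_mset f (mset (repeat_blocks k m y)) = (\<Sum>i=1..k. replicate_mset (m i) (f (y i)))"
  unfolding mset_map[symmetric]
  by (simp add: repeat_blocks_def map_concat mset_concat comp_def sum_list_distinct_conv_sum_set
        atLeastLessThanSuc_atLeastAtMost del: upt_Suc mset_map)

text \<open>The diagonal entry \<open>t\<close> of the characteristic matrix is written as
  \<open>(t + 2 * x i) - (x i + x i)\<close>. What is subtracted then depends on blocks only, on the
  diagonal too, and the determinant identity applies.\<close>

lemma char_poly_cell_matrix_repeat_blocks:
  fixes x :: "nat \<Rightarrow> real"
  assumes l: "\<forall>i\<in>{1..k}. l i \<ge> 1"
  shows "char_poly (cell_matrix (vec_of_list (repeat_blocks k l x)))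
       = (\<Prod>i=1..k. [:2 * x i, 1:] ^ (l i - 1)) * char_poly (block_matrix k l x)"
    (is "char_poly ?D = _")
proof -
  define bl where "bl = concat (map (\<lambda>i. replicate (l i) i) [1..<k+1])"
  define n where "n = length bl"
  \<comment> \<open>The block matrix lists the blocks in reverse: its position \<open>a\<close>,
    counted from 0, belongs to block \<open>k - a\<close>, hence the reflection here and in
    \<open>d\<close> and \<open>B\<close>.\<close>
  define g where "g i = k - bl ! i" for i
  define d where "d a = [:2 * x (k - a), 1:]" for a
  define B where "B a b = [:x (k - a) + x (k - b):]" for a b
  have bl: "bl ! i \<ge> 1" "bl ! i \<le> k" if "i < n" for i
    using nth_mem[of i bl] that unfolding n_def by (auto simp: bl_def)
  hence g: "g i < k" "k - g i = bl ! i" if "i < n" for i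
    using that unfolding g_def by (auto simp: Suc_le_eq) (metis diff_less less_le_trans)
  have card: "card {i. i < n \<and> g i = b} = l (k - b)" if "b < k" for b
  proof -
    have "{i. i < n \<and> g i = b} = {i. i < length bl \<and> k - b = bl ! i}"
      using that bl unfolding g_def n_def by (auto; fastforce)
    also have "card \<dots> = count_list bl (k - b)"
      by (simp add: count_list_eq_length_filter length_filter_conv_card)
    also have "\<dots> = l (k - b)"
      using that by (auto simp: bl_def count_list_concat_replicate simp del: upt_Suc)
    finally show ?thesis .
  qed
  have X: "repeat_blocks k l x = map x bl"
    by (simp only: repeat_blocks_conv_map bl_def)
  have D: "char_poly_matrix ?D = mat n n (\<lambda>(i, j). (if i = j then d (g i) else 0) - B (g i) (g j))"
    by (rule eq_matI)
       (auto simp: char_poly_matrix_def cell_matrix_def X n_def[symmetric] d_def B_def g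
          vec_of_list_index)
  have N: "char_poly_matrix (block_matrix k l x)
      = mat k k (\<lambda>(a, b). (if a = b then d a else 0) - B a b * of_nat (card {i. i < n \<and> g i = b}))"
    by (rule eq_matI)
       (auto simp: char_poly_matrix_def block_matrix_def card d_def B_def of_nat_poly algebra_simps)
  have "(\<Prod>i<n. d (g i)) = (\<Prod>i<n. [:2 * x (bl ! i), 1:])"
    by (rule prod.cong) (auto simp: d_def g)
  also have "\<dots> = prod_list (map (\<lambda>i. [:2 * x i, 1:]) bl)"
    by (simp add: prod.list_conv_set_nth n_def atLeast0LessThan)
  also have "\<dots> = (\<Prod>i=1..k. [:2 * x i, 1:] ^ l i)"
    unfolding bl_def prod_list_concat_replicate
    by (simp add: prod.distinct_set_conv_list[symmetric] atLeastLessThanSuc_atLeastAtMost del: upt_Suc)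
  \<comment> \<open>As \<open>l i \<ge> 1\<close>, one factor can be split off each power; together
    these form the product of the \<open>d a\<close>, which cancels at the end.\<close>
  also have "\<dots> = (\<Prod>i=1..k. [:2 * x i, 1:] ^ (l i - 1)) * (\<Prod>i=1..k. [:2 * x i, 1:])"
    unfolding prod.distrib[symmetric]
    by (intro prod.cong refl power_minus_mult[symmetric]) (use l in \<open>auto simp: Suc_le_eq\<close>)
  also have "(\<Prod>i=1..k. [:2 * x i, 1:]) = (\<Prod>a<k. d a)"
    by (rule prod.reindex_bij_witness[of _ "\<lambda>a. k - a" "\<lambda>a. k - a"]) (auto simp: d_def)
  finally have "char_poly ?D * (\<Prod>a<k. d a) = (\<Prod>i=1..k. [:2 * x i, 1:] ^ (l i - 1))
      * char_poly (block_matrix k l x) * (\<Prod>a<k. d a)"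
    using det_diag_minus_block_constant[of n g k d B] g
    by (simp add: char_poly_def D N mult_ac)
  moreover have "(\<Prod>a<k. d a) \<noteq> 0"
    by (simp add: d_def)
  ultimately show ?thesis
    by (simp only: mult_cancel_right simp_thms)
qed

lemma spectrum_mset_conv_char_poly:
  assumes "A \<in> carrier_mat n n"
  shows "spectrum_mset A = proots (map_poly complex_of_real (char_poly A))"
  unfolding spectrum_mset_def by (simp add: of_real_hom.char_poly_hom[OF assms])

text \<open>Roots of a nonzero product add up as multisets, and each factor
  \<open>t + 2 * x i\<close> contributes the root \<open>- 2 * x i\<close>, with multiplicity
  \<open>l i - 1\<close>.\<close>

lemma spectrum_mset_cell_matrix_repeat_blocks:
  assumes l: "\<forall>i\<in>{1..k}. l i \<ge> 1"
  shows "spectrum_mset (cell_matrix (vec_of_list (repeat_blocks k l x)))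
       = spectrum_mset (block_matrix k l x)
         + image_mset complex_of_real (mset (repeat_blocks k (\<lambda>i. l i - 1) (\<lambda>i. - 2 * x i)))"
proof -
  interpret map_poly_of_real: map_poly_comm_ring_hom complex_of_real ..
  let ?X = "vec_of_list (repeat_blocks k l x)"
  let ?p = "\<Prod>i=1..k. [:2 * complex_of_real (x i), 1:] ^ (l i - 1)"
  have D: "cell_matrix ?X \<in> carrier_mat (dim_vec ?X) (dim_vec ?X)"
    by (simp add: cell_matrix_def)
  have N: "block_matrix k l x \<in> carrier_mat k k"
    by (simp add: block_matrix_def)
  let ?q = "map_poly complex_of_real (char_poly (block_matrix k l x))"
  \<comment> \<open>A characteristic polynomial is monic, so it stays nonzero over the complex
    numbers.\<close>
  have q: "?q \<noteq> 0"
    using degree_monic_char_poly[OF N] by auto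
  have p: "?p \<noteq> 0"
    by simp
  have "spectrum_mset (cell_matrix ?X) = proots (?p * ?q)"
    by (simp add: spectrum_mset_conv_char_poly[OF D] char_poly_cell_matrix_repeat_blocks[OF l]
          map_poly_of_real.hom_mult map_poly_of_real.hom_prod map_poly_of_real.hom_power)
  also have "\<dots> = proots ?q + (\<Sum>i=1..k. replicate_mset (l i - 1) (- 2 * complex_of_real (x i)))"
    using p q by (simp add: proots_mult proots_prod proots_power repeat_mset_replicate_mset)
  also have "(\<Sum>i=1..k. replicate_mset (l i - 1) (- 2 * complex_of_real (x i)))
      = image_mset complex_of_real (mset (repeat_blocks k (\<lambda>i. l i - 1) (\<lambda>i. - 2 * x i)))"
    by (simp add: image_mset_repeat_blocks)
  finally show ?thesis
    by (simp add: spectrum_mset_conv_char_poly[OF N])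
qed

theorem theorem3p2:
  fixes k n :: nat and l :: "nat \<Rightarrow> nat" and lam x :: "nat \<Rightarrow> real"
    and S :: "real list" and X :: "real vec"
  assumes "k \<ge> 1" and "n \<ge> 1"
    and "\<forall>i\<in>{1..k}. l i > 1"
    and "(\<Sum>i=1..k. l i) = n"
    and "S = map lam [1..<k+1] @ repeat_blocks k (\<lambda>i. l i - 1) (\<lambda>i. lam (k + i))"
    and "lam 1 > 0" and "\<forall>i\<in>{2..2*k}. lam i < 0"
    and "\<forall>i\<in>{1..k}. x i = - lam (k + i) / 2"
    and "spectrum_mset (block_matrix k l x)
           = image_mset complex_of_real (mset (map lam [1..<k+1]))"
    and "X = vec_of_list (repeat_blocks k l (\<lambda>i. - lam (k + i) / 2))"
  shows "(\<exists>D. is_cell_matrix n D \<and> spectrum_mset D = image_mset complex_of_real (mset S))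
       \<and> X \<in> carrier_vec n \<and> (\<forall>i<n. X $ i > 0)
       \<and> spectrum_mset (cell_matrix X) = image_mset complex_of_real (mset S)"
proof -
  have X: "X = vec_of_list (repeat_blocks k l x)"
    unfolding assms(10) repeat_blocks_def using assms(8)
    by (auto intro!: arg_cong[of _ _ vec_of_list] arg_cong[of _ _ concat] simp del: upt_Suc)
  have S: "repeat_blocks k (\<lambda>i. l i - 1) (\<lambda>i. - 2 * x i)
      = repeat_blocks k (\<lambda>i. l i - 1) (\<lambda>i. lam (k + i))"
    unfolding repeat_blocks_def using assms(8)
    by (auto intro!: arg_cong[of _ _ concat] simp del: upt_Suc)
  have dim: "X \<in> carrier_vec n"
    unfolding assms(4)[symmetric] X
    by (intro carrier_vecI)
       (simp add: repeat_blocks_def length_concat comp_def sum_list_distinct_conv_sum_set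
          atLeastLessThanSuc_atLeastAtMost del: upt_Suc)
  \<comment> \<open>Since \<open>k \<ge> 1\<close>, every index \<open>k + i\<close> with
    \<open>1 \<le> i \<le> k\<close> lies in \<open>{2..2*k}\<close>, where \<open>lam\<close> is
    negative.\<close>
  have "set (repeat_blocks k l x) \<subseteq> {0<..}"
    using assms(1,7,8) by (auto simp: repeat_blocks_def simp del: upt_Suc)
  moreover have "length (repeat_blocks k l x) = n"
    using carrier_vecD[OF dim] by (simp add: X)
  ultimately have pos: "\<forall>i<n. X $ i > 0"
    unfolding X vec_of_list_index by (auto dest: nth_mem)
  have "\<forall>i\<in>{1..k}. l i \<ge> 1"
    using assms(3) by auto
  from spectrum_mset_cell_matrix_repeat_blocks[OF this, of x]
  \<comment> \<open>The block matrix supplies the first \<open>k\<close> eigenvalues by hypothesis;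
    the repeated ones are \<open>- 2 * x i = lam (k + i)\<close>.\<close>
  have spec: "spectrum_mset (cell_matrix X) = image_mset complex_of_real (mset S)"
    by (simp only: X S assms(5,9) mset_append image_mset_union)
  show ?thesis
    using dim pos spec unfolding is_cell_matrix_def by blast
qed

end
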